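(* Consider any instance of the Online Budgeted Repeated Matching (OBRM) problem (defined in the context) in which every edge weight satisfies $w(i,j)\le \tfrac12 C_i$ for every server $i$ and job $j$. Let $A(T)=\bigcup_{t\le T}M(t)$ be the set of edges selected by the algorithm ONLINEGREEDY (defined in the context), and let $\mathrm{OPT}$ be the maximum total weight of a feasible set of edges for the instance. Then $W(A(T))\ge \tfrac13\,\mathrm{OPT}$, i.e. ONLINEGREEDY is $3$-competitive.
   Context: OBRM problem: there is a set $I=\{1,\dots,n\}$ of servers, server $i$ having capacity $C_i>0$. At each time step $t\in\{1,\dots,T\}$ a set of jobs $J(t)$ and a set $E(t)$ of edges between servers $I$ and jobs $J(t)$ are revealed, forming the bipartite graph $G(t)=(I\cup J(t),E(t))$; each edge $e=(i,j)$ has a nonnegative weight $w(e)=w(i,j)$ (the resources of server $i$ consumed if job $j$ is assigned to $i$; a job may have different weights on different servers). Let $E=\bigcup_{t\le T}E(t)$. For a set of edges $F$, $W(F)=\sum_{e\in F}w(e)$ and $F(t)=F\cap E(t)$. A set $F\subseteq E$ is feasible if (i) $F(t)$ is a matching for every $t$ (each server and each job is incident to at most one edge of $F(t)$), and (ii) for each server $i$ the total weight of edges of $F$ incident to $i$ is at most $C_i$. An online algorithm must choose $M(t)\subseteq E(t)$ irrevocably at time $t$ knowing only $G(1),\dots,G(t)$; the goal is to maximize $W(\bigcup_t M(t))$ subject to feasibility. An algorithm is $\gamma$-competitive if on every instance its total weight is at least $1/\gamma$ times the optimal (offline) feasible weight. Subroutine GREEDY$(G,S)$: given a weighted bipartite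 graph $G$ between servers and jobs and a set $S$ of servers, start with $M=\emptyset$ and scan the edges of $G$ in non-increasing order of weight; add edge $(i,j)$ to $M$ if $i\in S$ and $M\cup\{(i,j)\}$ is still a matching. Return $M$. ONLINEGREEDY: initially $S=I$ (the set of active servers) and $A_i(0)=\emptyset$ for all $i$. For $t=1,\dots,T$: set $M(t)=$GREEDY$(G(t),S)$ and $A(t)=A(t-1)\cup M(t)$; for each $(i,j)\in M(t)$, letting $A_i(t)$ be the edges of $A(t)$ incident to server $i$, if $W(A_i(t))>\tfrac12 C_i$ then remove $i$ from $S$.
   Formalization: The edge sets E(t) of different time steps are assumed pairwise disjoint (as when new jobs arrive at each step); if the same edge could recur at several steps, the algorithm might select it every time and the bound would fail. *)

theory Defs
  imports Complex_Main
begin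

text \<open>
  An edge is a pair (server, job); the weight function is defined on edges. Edges presented at
  different times are different edges: this is needed for the part of an edge set \<open>F\<close>
  chosen at time \<open>t\<close> to be \<open>F \<inter> E t\<close>.
\<close>

locale obrm =
  fixes n T :: nat
    and C :: "nat \<Rightarrow> real"
    and J :: "nat \<Rightarrow> 'j set"
    and E :: "nat \<Rightarrow> (nat \<times> 'j) set"
    and w :: "nat \<times> 'j \<Rightarrow> real"
  assumes capacity_pos: "\<And>i. i \<in> {1..n} \<Longrightarrow> C i > 0"
    and finite_jobs: "\<And>t. t \<in> {1..T} \<Longrightarrow> finite (J t)"
    and edges_bipartite: "\<And>t. t \<in> {1..T} \<Longrightarrow> E t \<subseteq> {1..n} \<times> J t"
    and edges_disjoint:
      "\<And>s t. s \<in> {1..T} \<Longrightarrow> t \<in> {1..T} \<Longrightarrow> s \<noteq> t \<Longrightarrow> E s \<inter> E t = {}"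
    and weight_nonneg: "\<And>t e. t \<in> {1..T} \<Longrightarrow> e \<in> E t \<Longrightarrow> 0 \<le> w e"

definition matching :: "(nat \<times> 'j) set \<Rightarrow> bool" where
  "matching F \<longleftrightarrow>
     (\<forall>e\<in>F. \<forall>f\<in>F. fst e = fst f \<longrightarrow> e = f) \<and>
     (\<forall>e\<in>F. \<forall>f\<in>F. snd e = snd f \<longrightarrow> e = f)"

definition weight :: "(nat \<times> 'j \<Rightarrow> real) \<Rightarrow> (nat \<times> 'j) set \<Rightarrow> real" where
  "weight w F = (\<Sum>e\<in>F. w e)"

definition incident :: "nat \<Rightarrow> (nat \<times> 'j) set \<Rightarrow> (nat \<times> 'j) set" where
  "incident i F = {e \<in> F. fst e = i}"

definition feasible ::
  "nat \<Rightarrow> nat \<Rightarrow> (nat \<Rightarrow> real) \<Rightarrow> (nat \<Rightarrow> (nat \<times> 'j) set) \<Rightarrow> (nat \<times> 'j \<Rightarrow> real)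
     \<Rightarrow> (nat \<times> 'j) set \<Rightarrow> bool" where
  "feasible n T C E w F \<longleftrightarrow>
     F \<subseteq> (\<Union>t\<in>{1..T}. E t) \<and>
     (\<forall>t\<in>{1..T}. matching (F \<inter> E t)) \<and>
     (\<forall>i\<in>{1..n}. weight w (incident i F) \<le> C i)"

definition OPT ::
  "nat \<Rightarrow> nat \<Rightarrow> (nat \<Rightarrow> real) \<Rightarrow> (nat \<Rightarrow> (nat \<times> 'j) set) \<Rightarrow> (nat \<times> 'j \<Rightarrow> real) \<Rightarrow> real" where
  "OPT n T C E w = Max (weight w ` {F. feasible n T C E w F})"

text \<open>The maximum is over a finite nonempty set.\<close>

lemma (in obrm) finite_feasible: "finite {F. feasible n T C E w F}"
proof (rule finite_subset)
  have "finite (E t)" if "t \<in> {1..T}" for t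
    using finite_subset[OF edges_bipartite] finite_jobs that by blast
  then show "finite (Pow (\<Union>t\<in>{1..T}. E t))"
    by blast
qed (auto simp: feasible_def)

lemma (in obrm) feasible_empty: "feasible n T C E w {}"
  using capacity_pos by (auto simp: feasible_def matching_def weight_def incident_def less_imp_le)

text \<open>
  The order in which edges of equal weight are scanned is left open: a scan order is any
  enumeration of the edges by non-increasing weight.
\<close>

definition scan_order :: "(nat \<times> 'j \<Rightarrow> real) \<Rightarrow> (nat \<times> 'j) set \<Rightarrow> (nat \<times> 'j) list \<Rightarrow> bool" where
  "scan_order w F es \<longleftrightarrow> distinct es \<and> set es = F \<and> sorted_wrt (\<lambda>e f. w e \<ge> w f) es"

definition greedy :: "(nat \<times> 'j) list \<Rightarrow> nat set \<Rightarrow> (nat \<times> 'j) set" where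
  "greedy es S =
     foldl (\<lambda>M e. if fst e \<in> S \<and> matching (M \<union> {e}) then M \<union> {e} else M) {} es"

text \<open>
  The state after time \<open>t\<close> is the pair of the set of active servers and the set of
  edges selected so far; \<open>ord t\<close> is the scan order used at time \<open>t\<close>.
\<close>

primrec online_greedy ::
  "nat \<Rightarrow> (nat \<Rightarrow> real) \<Rightarrow> (nat \<times> 'j \<Rightarrow> real) \<Rightarrow> (nat \<Rightarrow> (nat \<times> 'j) list) \<Rightarrow> nat
     \<Rightarrow> nat set \<times> (nat \<times> 'j) set" where
  "online_greedy n C w ord 0 = ({1..n}, {})"
| "online_greedy n C w ord (Suc t) =
     (let (S, A) = online_greedy n C w ord t;
          M = greedy (ord (Suc t)) S;
          A' = A \<union> M
      in (S - {i. (\<exists>j. (i, j) \<in> M) \<and> weight w (incident i A') > C i / 2}, A'))"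

definition selected ::
  "nat \<Rightarrow> (nat \<Rightarrow> real) \<Rightarrow> (nat \<times> 'j \<Rightarrow> real) \<Rightarrow> (nat \<Rightarrow> (nat \<times> 'j) list) \<Rightarrow> nat
     \<Rightarrow> (nat \<times> 'j) set" where
  "selected n C w ord t = snd (online_greedy n C w ord t)"

end

theory Submission
  imports Defs
begin

text \<open>
  Fix a feasible set \<open>F\<close> and call a server active if it is still active at the end. A server \<open>i\<close>
  that was deactivated carries more than \<open>C i / 2\<close>, that is, more than half of what \<open>F\<close>
  can assign to it. Every edge of \<open>F\<close> at an active server meets, within its time step, a selected
  edge that is at least as heavy. Charging along common servers costs at most the weight selected at
  active servers, charging along common jobs at most the whole selected weight. In total, edges at
  deactivated servers are charged with a factor \<open>2 + 1\<close>, those at active servers with \<open>1 + 1\<close>.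
\<close>

section \<open>Greedy matchings, injective charging and sums of weights\<close>

lemma matching_iff_inj_on: "matching F \<longleftrightarrow> inj_on fst F \<and> inj_on snd F"
  by (auto simp: matching_def inj_on_def)

lemma greedy_snoc:
  "greedy (es @ [e]) S =
     (if fst e \<in> S \<and> matching (insert e (greedy es S)) then insert e (greedy es S)
      else greedy es S)"
  by (simp add: greedy_def)

lemma greedy_subset: "greedy es S \<subseteq> {e \<in> set es. fst e \<in> S}"
  by (induction es rule: rev_induct) (auto simp: greedy_snoc greedy_def[of "[]"])

lemma matching_greedy: "matching (greedy es S)"
proof (induction es rule: rev_induct)
  case Nil
  show ?case by (simp add: greedy_def matching_def)
next
  case (snoc e es)
  then show ?case by (simp add: greedy_snoc)
qed

text \<open>A chosen edge dominates itself. An edge rejected despite its server lying in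
  \<open>S\<close> clashes with an edge already chosen, which was scanned earlier and so is at least
  as heavy. Chosen edges are never dropped, so witnesses persist as the scan goes on.\<close>

lemma greedy_dominates:
  assumes "sorted_wrt (\<lambda>e f. w e \<ge> w f) es" and "e \<in> set es" and "fst e \<in> S"
  shows "\<exists>g\<in>greedy es S. w e \<le> (w g :: real) \<and> (fst g = fst e \<or> snd g = snd e)"
  using assms
proof (induction es arbitrary: e rule: rev_induct)
  case Nil
  then show ?case by simp
next
  case (snoc f es)
  show ?case
  proof (cases "e \<in> set es")
    case True
    with snoc have "\<exists>g\<in>greedy es S. w e \<le> w g \<and> (fst g = fst e \<or> snd g = snd e)"
      by (simp add: sorted_wrt_append)
    then show ?thesis by (auto simp: greedy_snoc)
  next
    case False
    with snoc.prems have [simp]: "f = e" by simp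
    show ?thesis
    proof (cases "matching (insert e (greedy es S))")
      case True
      with snoc.prems show ?thesis by (auto simp: greedy_snoc)
    next
      case False
      with matching_greedy[of es S] obtain g
        where g: "g \<in> greedy es S" "fst g = fst e \<or> snd g = snd e"
        by (auto simp: matching_def)
      with greedy_subset[of es S] snoc.prems(1) have "w e \<le> w g"
        by (auto simp: sorted_wrt_append)
      with g False show ?thesis by (auto simp: greedy_snoc)
    qed
  qed
qed

text \<open>The last hypothesis on \<open>R\<close> ensures that no \<open>g\<close> is charged by
  two elements of \<open>F\<close>. The choice of charged edges is then injective, and nonnegativity
  covers the elements of \<open>B\<close> that are not charged.\<close>

lemma weight_le_charging:
  assumes "finite B" and "\<And>g. g \<in> B \<Longrightarrow> 0 \<le> w g"
    and "\<And>f. f \<in> F \<Longrightarrow> \<exists>g\<in>B. w f \<le> w g \<and> R f g"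
    and "\<And>f f' g. f \<in> F \<Longrightarrow> f' \<in> F \<Longrightarrow> R f g \<Longrightarrow> R f' g \<Longrightarrow> f = f'"
  shows "weight w F \<le> weight w B"
proof -
  obtain h where h: "\<And>f. f \<in> F \<Longrightarrow> h f \<in> B \<and> w f \<le> w (h f) \<and> R f (h f)"
    using assms(3) by metis
  have "inj_on h F"
    using assms(4) h by (metis inj_onI)
  then have "(\<Sum>f\<in>F. w (h f)) = sum w (h ` F)"
    by (simp add: sum.reindex)
  also have "\<dots> \<le> sum w B"
    using assms(1,2) h by (intro sum_mono2) auto
  finally show ?thesis
    using sum_mono[of F w "\<lambda>f. w (h f)"] h by (simp add: weight_def)
qed

lemma sum_weight_incident:
  assumes "finite F" and "finite I"
  shows "(\<Sum>i\<in>I. weight w (incident i F)) = weight w {e \<in> F. fst e \<in> I}"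
proof -
  have "incident i F = {e \<in> {e \<in> F. fst e \<in> I}. fst e = i}" if "i \<in> I" for i
    using that by (auto simp: incident_def)
  then show ?thesis
    using sum.group[of "{e \<in> F. fst e \<in> I}" I fst w] assms by (auto simp: weight_def)
qed

lemma weight_split:
  assumes "finite F"
  shows "weight w F = weight w {e \<in> F. P e} + weight w {e \<in> F. \<not> P e}"
  unfolding weight_def
  by (subst sum.union_disjoint[symmetric]) (use assms in \<open>auto intro: sum.cong\<close>)

section \<open>Evolution of the algorithm's state\<close>

definition active ::
  "nat \<Rightarrow> (nat \<Rightarrow> real) \<Rightarrow> (nat \<times> 'j \<Rightarrow> real) \<Rightarrow> (nat \<Rightarrow> (nat \<times> 'j) list) \<Rightarrow> nat \<Rightarrow> nat set" where
  "active n C w ord t = fst (online_greedy n C w ord t)"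

lemma active_0: "active n C w ord 0 = {1..n}"
  by (simp add: active_def)

lemma selected_0: "selected n C w ord 0 = {}"
  by (simp add: selected_def)

lemma selected_Suc:
  "selected n C w ord (Suc t) =
     selected n C w ord t \<union> greedy (ord (Suc t)) (active n C w ord t)"
  by (simp add: selected_def active_def Let_def split: prod.split)

lemma active_Suc:
  "active n C w ord (Suc t) = active n C w ord t -
     {i. (\<exists>j. (i, j) \<in> greedy (ord (Suc t)) (active n C w ord t)) \<and>
         weight w (incident i (selected n C w ord (Suc t))) > C i / 2}"
  by (simp add: selected_def active_def Let_def split: prod.split)

lemma active_antimono: "s \<le> t \<Longrightarrow> active n C w ord t \<subseteq> active n C w ord s"
  by (rule lift_Suc_antimono_le[of "active n C w ord"]) (auto simp: active_Suc)

text \<open>Step \<open>s\<close> works with the servers left active by step \<open>s - 1\<close>;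
  as \<open>s\<close> starts at 1, the subtraction does not truncate.\<close>

lemma selected_eq:
  "selected n C w ord t = (\<Union>s\<in>{1..t}. greedy (ord s) (active n C w ord (s - 1)))"
  by (induction t) (auto simp: selected_0 selected_Suc atLeastAtMostSuc_conv)

text \<open>A single run with \<open>ord\<close> arbitrary among the scan orders, so the results
  hold for every way of breaking ties.\<close>

locale obrm_run = obrm n T C J E w
  for n T :: nat and C and J :: "nat \<Rightarrow> 'j set" and E w +
  fixes ord :: "nat \<Rightarrow> (nat \<times> 'j) list"
  assumes weight_le_half: "\<And>t e. t \<in> {1..T} \<Longrightarrow> e \<in> E t \<Longrightarrow> w e \<le> C (fst e) / 2"
    and scan_order: "\<And>t. t \<in> {1..T} \<Longrightarrow> scan_order w (E t) (ord t)"
begin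

abbreviation "M t \<equiv> greedy (ord t) (active n C w ord (t - 1))"
abbreviation "A t \<equiv> selected n C w ord t"
abbreviation "S t \<equiv> active n C w ord t"

section \<open>Selected edges and server loads in a run\<close>

lemma set_ord: "t \<in> {1..T} \<Longrightarrow> set (ord t) = E t"
  using scan_order by (auto simp: scan_order_def)

lemma M_subset: "t \<in> {1..T} \<Longrightarrow> M t \<subseteq> E t"
  using greedy_subset set_ord by fast

lemma A_subset: "t \<le> T \<Longrightarrow> A t \<subseteq> (\<Union>s\<in>{1..T}. E s)"
  unfolding selected_eq by (rule UN_mono) (auto intro!: M_subset simp del: One_nat_def)

lemma finite_edges: "finite (\<Union>t\<in>{1..T}. E t)"
  using finite_subset[OF edges_bipartite] finite_jobs by blast

lemma weight_Un_le:
  assumes "X \<union> Y \<subseteq> (\<Union>t\<in>{1..T}. E t)"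
  shows "weight w (X \<union> Y) \<le> weight w X + weight w Y"
proof -
  have "finite X" "finite Y"
    using assms finite_edges finite_subset by blast+
  moreover have "0 \<le> sum w (X \<inter> Y)"
    using assms weight_nonneg by (intro sum_nonneg) blast
  ultimately show ?thesis by (simp add: weight_def sum_Un)
qed

lemma finite_A: "t \<le> T \<Longrightarrow> finite (A t)"
  by (rule finite_subset[OF A_subset finite_edges])

text \<open>Edge sets of different steps are disjoint, so an edge of \<open>E t\<close> can only
  have been selected at step \<open>t\<close>.\<close>

lemma A_Int_E:
  assumes "t \<in> {1..T}"
  shows "A T \<inter> E t = M t"
proof
  show "M t \<subseteq> A T \<inter> E t"
    using M_subset assms by (auto simp: selected_eq)
  show "A T \<inter> E t \<subseteq> M t"
  proof
    fix e assume "e \<in> A T \<inter> E t"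
    then obtain s where s: "s \<in> {1..T}" "e \<in> M s" "e \<in> E t"
      by (auto simp: selected_eq)
    with M_subset edges_disjoint[of s t] assms have "s = t" by blast
    with s show "e \<in> M t" by simp
  qed
qed

text \<open>A matching gives each server at most one new edge. This is where the bound of half the
  capacity on edge weights enters.\<close>

lemma weight_incident_Suc_le:
  assumes "Suc t \<le> T" "i \<in> {1..n}"
  shows "weight w (incident i (A (Suc t))) \<le> weight w (incident i (A t)) + C i / 2"
proof -
  have M: "M (Suc t) \<subseteq> E (Suc t)" "inj_on fst (M (Suc t))"
    using M_subset[of "Suc t"] assms(1) matching_greedy[unfolded matching_iff_inj_on] by auto
  have "C i > 0" using capacity_pos assms by simp
  have new: "weight w (incident i (M (Suc t))) \<le> C i / 2"
  proof (cases "incident i (M (Suc t)) = {}")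
    case True
    with \<open>C i > 0\<close> show ?thesis by (simp add: weight_def)
  next
    case False
    then obtain e where e: "e \<in> M (Suc t)" "fst e = i"
      by (auto simp: incident_def)
    with M(2) have "incident i (M (Suc t)) = {e}"
      by (auto simp: incident_def dest: inj_onD)
    with e M(1) weight_le_half[of "Suc t" e] assms(1) show ?thesis
      by (auto simp: weight_def)
  qed
  have "incident i (A (Suc t)) = incident i (A t) \<union> incident i (M (Suc t))"
    by (auto simp: selected_Suc incident_def)
  moreover have "weight w (incident i (A t) \<union> incident i (M (Suc t)))
      \<le> weight w (incident i (A t)) + weight w (incident i (M (Suc t)))"
    by (rule weight_Un_le, rule order_trans[OF _ A_subset[OF assms(1)]])
      (auto simp: selected_Suc incident_def)
  ultimately show ?thesis using new by simp
qed

text \<open>The edge that pushes a load above half the capacity adds at most the other half, and the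
  load is frozen afterwards. The lower bound for inactive servers serves the ratio, the upper bounds
  serve feasibility.\<close>

lemma load_invariant:
  assumes "t \<le> T" "i \<in> {1..n}"
  shows "(i \<in> S t \<longrightarrow> weight w (incident i (A t)) \<le> C i / 2) \<and>
    (i \<notin> S t \<longrightarrow> C i / 2 < weight w (incident i (A t)) \<and> weight w (incident i (A t)) \<le> C i)"
  using assms(1)
proof (induction t)
  case 0
  then show ?case
    using capacity_pos[OF assms(2)] assms(2)
    by (simp add: active_0 selected_0 incident_def weight_def)
next
  case (Suc t)
  show ?case
  proof (cases "\<exists>j. (i, j) \<in> M (Suc t)")
    case True
    \<comment> \<open>Only active servers receive edges, so the load before this step was at most
      \<open>C i / 2\<close>.\<close>
    then have "i \<in> S t" using greedy_subset by fastforce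
    with True Suc weight_incident_Suc_le[of t i] assms(2) show ?thesis
      by (auto simp: active_Suc)
  next
    case False
    then have "incident i (A (Suc t)) = incident i (A t)"
      by (auto simp: selected_Suc incident_def)
    with False Suc show ?thesis by (simp add: active_Suc)
  qed
qed

section \<open>Feasibility and the factor 3\<close>

lemma feasible_A: "feasible n T C E w (A T)"
  unfolding feasible_def
proof (intro conjI ballI)
  show "A T \<subseteq> (\<Union>t\<in>{1..T}. E t)" by (rule A_subset) simp
  show "matching (A T \<inter> E t)" if "t \<in> {1..T}" for t
    using that by (simp add: A_Int_E matching_greedy)
  show "weight w (incident i (A T)) \<le> C i" if "i \<in> {1..n}" for i
    using load_invariant[OF order_refl that] capacity_pos[OF that] by (cases "i \<in> S T") auto
qed

text \<open>Charging within a time step along a common key, used with \<open>k = fst\<close>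
  (server) and \<open>k = snd\<close> (job). The charged edge determines both the step and the key,
  and these determine the edge of \<open>F\<close>.\<close>

lemma weight_le_charging_key:
  assumes "B \<subseteq> (\<Union>t\<in>{1..T}. E t)"
    and "\<And>t. t \<in> {1..T} \<Longrightarrow> inj_on k (F \<inter> E t)"
    and "\<And>f. f \<in> F \<Longrightarrow> \<exists>t\<in>{1..T}. \<exists>g\<in>B \<inter> E t. f \<in> E t \<and> w f \<le> w g \<and> k g = k f"
  shows "weight w F \<le> weight w B"
proof (rule weight_le_charging[where R = "\<lambda>f g. \<exists>t\<in>{1..T}. f \<in> E t \<and> g \<in> E t \<and> k g = k f"])
  show "finite B" using assms(1) finite_edges by (rule finite_subset)
  show "0 \<le> w g" if "g \<in> B" for g using that assms(1) weight_nonneg by blast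
  show "\<exists>g\<in>B. w f \<le> w g \<and> (\<exists>t\<in>{1..T}. f \<in> E t \<and> g \<in> E t \<and> k g = k f)" if "f \<in> F" for f
    using assms(3)[OF that] by blast
next
  fix f f' g
  assume f: "f \<in> F" "f' \<in> F"
    and "\<exists>t\<in>{1..T}. f \<in> E t \<and> g \<in> E t \<and> k g = k f"
    and "\<exists>t\<in>{1..T}. f' \<in> E t \<and> g \<in> E t \<and> k g = k f'"
  then obtain s t where *: "s \<in> {1..T}" "t \<in> {1..T}" "f \<in> E s" "f' \<in> E t" "g \<in> E s" "g \<in> E t"
      "k f = k f'"
    by metis
  with edges_disjoint[of s t] have "s = t" by blast
  with * f assms(2)[of t] show "f = f'" by (auto dest: inj_onD)
qed

lemma weight_le_3_selected:
  assumes "feasible n T C E w F"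
  shows "weight w F \<le> 3 * weight w (A T)"
proof -
  \<comment> \<open>\<open>?I\<close> is the set of deactivated servers. \<open>?R fst\<close> and
    \<open>?R snd\<close> collect the edges of \<open>F\<close> at active servers that can be
    charged to a selected edge of the same step along the server and along the job; they may
    overlap.\<close>
  let ?I = "{1..n} - S T"
  let ?F = "{f \<in> F. fst f \<notin> ?I}" and ?A = "{e \<in> A T. fst e \<notin> ?I}"
  let ?R = "\<lambda>k. {f \<in> ?F. \<exists>t\<in>{1..T}. \<exists>g\<in>M t. f \<in> E t \<and> w f \<le> w g \<and> k g = k f}"
  have F: "F \<subseteq> (\<Union>t\<in>{1..T}. E t)" "\<And>t. t \<in> {1..T} \<Longrightarrow> matching (F \<inter> E t)"
    "\<And>i. i \<in> {1..n} \<Longrightarrow> weight w (incident i F) \<le> C i"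
    using assms by (auto simp: feasible_def)
  have finF: "finite F" using F(1) finite_edges by (rule finite_subset)
  have finA: "finite (A T)" by (simp add: finite_A)
  have A_edges: "A T \<subseteq> (\<Union>t\<in>{1..T}. E t)" by (rule A_subset) simp
  have nonneg: "\<And>e. e \<in> (\<Union>t\<in>{1..T}. E t) \<Longrightarrow> 0 \<le> w e" using weight_nonneg by blast
  have injF: "inj_on fst (X \<inter> E t)" "inj_on snd (X \<inter> E t)" if "t \<in> {1..T}" "X \<subseteq> F" for t X
    using F(2)[OF that(1)] that(2) unfolding matching_iff_inj_on by (auto intro: inj_on_subset)

  have inactive: "weight w {f \<in> F. fst f \<in> ?I} \<le> 2 * weight w {e \<in> A T. fst e \<in> ?I}"
  proof -
    \<comment> \<open>At a deactivated server \<open>F\<close> has load at most \<open>C i\<close>,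
      while the selected load exceeds \<open>C i / 2\<close>.\<close>
    have "weight w (incident i F) \<le> 2 * weight w (incident i (A T))" if "i \<in> ?I" for i
      using that F(3)[of i] load_invariant[of T i] by auto
    then have "(\<Sum>i\<in>?I. weight w (incident i F)) \<le> (\<Sum>i\<in>?I. 2 * weight w (incident i (A T)))"
      by (rule sum_mono)
    then show ?thesis
      by (simp only: sum_distrib_left[symmetric] sum_weight_incident finF finA
          finite_Diff finite_atLeastAtMost)
  qed

  have "?F \<subseteq> ?R fst \<union> ?R snd"
  proof
    fix f assume f: "f \<in> ?F"
    then obtain t where t: "t \<in> {1..T}" "f \<in> E t" using F(1) by blast
    with edges_bipartite have "fst f \<in> {1..n}" by fastforce
    with f have "fst f \<in> S T" by simp
    \<comment> \<open>Servers are never reactivated, so this one was already available to greedy at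
      step \<open>t\<close>.\<close>
    also have "S T \<subseteq> S (t - 1)" using t by (intro active_antimono) auto
    finally have "\<exists>g\<in>M t. w f \<le> w g \<and> (fst g = fst f \<or> snd g = snd f)"
      using scan_order[OF t(1)] t(2) by (intro greedy_dominates) (auto simp: scan_order_def)
    with f t show "f \<in> ?R fst \<union> ?R snd" by blast
  qed
  then have "weight w ?F \<le> weight w (?R fst \<union> ?R snd)"
    unfolding weight_def using F(1) finF by (intro sum_mono2) (auto intro!: nonneg)
  also have "\<dots> \<le> weight w (?R fst) + weight w (?R snd)"
    by (rule weight_Un_le) (use F(1) in blast)
  \<comment> \<open>A selected edge sharing its server with \<open>f\<close> lies at an active
    server too, so these charges stay within \<open>?A\<close>.\<close>
  also have "weight w (?R fst) \<le> weight w ?A"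
  proof (rule weight_le_charging_key[where k = fst])
    show "?A \<subseteq> (\<Union>t\<in>{1..T}. E t)" using A_edges by blast
    show "inj_on fst (?R fst \<inter> E t)" if "t \<in> {1..T}" for t by (rule injF) (use that in auto)
    show "\<exists>t\<in>{1..T}. \<exists>g\<in>?A \<inter> E t. f \<in> E t \<and> w f \<le> w g \<and> fst g = fst f"
      if f: "f \<in> ?R fst" for f
    proof -
      from f obtain t g where tg: "t \<in> {1..T}" "g \<in> M t" "f \<in> E t" "w f \<le> w g" "fst g = fst f"
        by blast
      then have "g \<in> ?A \<inter> E t" using A_Int_E f by auto
      with tg show ?thesis by blast
    qed
  qed
  \<comment> \<open>A selected edge sharing only the job may lie at any server, so all of
    \<open>A T\<close> can be charged.\<close>
  also have "weight w (?R snd) \<le> weight w (A T)"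
  proof (rule weight_le_charging_key[where k = snd])
    show "A T \<subseteq> (\<Union>t\<in>{1..T}. E t)" by (rule A_edges)
    show "inj_on snd (?R snd \<inter> E t)" if "t \<in> {1..T}" for t by (rule injF) (use that in auto)
    show "\<exists>t\<in>{1..T}. \<exists>g\<in>A T \<inter> E t. f \<in> E t \<and> w f \<le> w g \<and> snd g = snd f"
      if "f \<in> ?R snd" for f
      using that A_Int_E by blast
  qed
  finally have act: "weight w ?F \<le> weight w ?A + weight w (A T)" by simp

  \<comment> \<open>With a and b the selected weights at active and deactivated servers, the bounds
    add up to 2 b + a + (a + b) = 3 (a + b) - a, and a is nonnegative.\<close>
  have "0 \<le> weight w ?A"
    unfolding weight_def using A_edges by (intro sum_nonneg nonneg) auto
  with inactive act weight_split[OF finF, of w "\<lambda>e. fst e \<in> ?I"]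
    weight_split[OF finA, of w "\<lambda>e. fst e \<in> ?I"]
  show ?thesis by linarith
qed

text \<open>The maximum is attained, so \<open>OPT\<close> is the weight of some feasible
  set.\<close>

lemma OPT_le_3_selected: "OPT n T C E w \<le> 3 * weight w (A T)"
proof -
  have "OPT n T C E w \<in> weight w ` {F. feasible n T C E w F}"
    unfolding OPT_def using finite_feasible feasible_empty by (intro Max_in) auto
  then show ?thesis using weight_le_3_selected by auto
qed

end

theorem theorem1:
  fixes n T :: nat
    and C :: "nat \<Rightarrow> real"
    and J :: "nat \<Rightarrow> 'j set"
    and E :: "nat \<Rightarrow> (nat \<times> 'j) set"
    and w :: "nat \<times> 'j \<Rightarrow> real"
    and ord :: "nat \<Rightarrow> (nat \<times> 'j) list"
  assumes "obrm n T C J E w"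
    and "\<And>t i j. t \<in> {1..T} \<Longrightarrow> (i, j) \<in> E t \<Longrightarrow> w (i, j) \<le> C i / 2"
    and "\<And>t. t \<in> {1..T} \<Longrightarrow> scan_order w (E t) (ord t)"
  shows "feasible n T C E w (selected n C w ord T) \<and>
    weight w (selected n C w ord T) \<ge> 1 / 3 * OPT n T C E w"
proof -
  interpret obrm n T C J E w by (rule assms(1))
  interpret obrm_run n T C J E w ord
    by unfold_locales (use assms(2,3) in auto)
  show ?thesis using feasible_A OPT_le_3_selected by simp
qed

end
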